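(* Let $(E,\mathscr{T})$ be a topological space and let $\le$ be any preorder on $E$. Consider the following properties of $(E,\mathscr{T})$: (i) $E$ is a second-countable $k_\omega$-space; (ii) $E$ is second-countable and locally compact; (iii) $E$ is a pseudo-metrizable hemicompact $k$-space; (iv) $E$ is a locally compact pseudo-Polish space. Then $(iv)\Leftrightarrow(iii)\Rightarrow(ii)\Rightarrow(i)$. Furthermore, if $(E,\mathscr{T},\le)$ is a locally convex semiclosed preordered space then $(i)\Rightarrow(ii)$, and if $(E,\mathscr{T},\le)$ is a locally convex closed preordered space then $(ii)\Rightarrow(iii)$. (Choosing for $\le$ the discrete order, $x\le y$ iff $x=y$, which is locally convex, it follows that $(i)\Rightarrow(ii)$ holds also whenever $\mathscr{T}$ is $T_1$, and $(ii)\Rightarrow(iii)$ holds also whenever $\mathscr{T}$ is $T_2$.) In particular, the four properties are all equivalent if $(E,\mathscr{T},\le)$ is a locally convex closed preordered space (e.g. if $\mathscr{T}$ is Hausdorff).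
   Context: No Hausdorff assumption is included in any of the notions below unless stated. A preorder is a reflexive and transitive relation. For a preordered set $E$, $i(x)=\{y\in E: x\le y\}$, $d(x)=\{y\in E: y\le x\}$, $i(S)=\bigcup_{s\in S} i(s)$, $d(S)=\bigcup_{s\in S}d(s)$. A subset $S\subset E$ is increasing if $i(S)=S$, decreasing if $d(S)=S$, and convex if it is the intersection of an increasing and a decreasing set. A topological space with a preorder is: a semiclosed preordered space if $i(x)$ and $d(x)$ are closed for every $x\in E$; a closed preordered space if the graph $G(\le)=\{(x,y):x\le y\}$ is closed in $E\times E$; locally convex if for every $x\in E$ the convex neighborhoods of $x$ form a base for the neighborhood system of $x$. A topological space is locally compact if every point admits a compact neighborhood. It is a $k_\omega$-space if there is a countable sequence $K_i$ of compact sets with $\bigcup_{i=1}^\infty K_i=E$ such that, for every $O\subset E$, $O$ is open iff $O\cap K_i$ is open in $K_i$ for every $i$. It is hemicompact if there is a countable sequence $K_i$ of compact sets such that every compact set is contained in some $K_i$. It is a $k$-space if for every $O\subset E$, $O$ is open iff for every compact $K\subset E$, $O\cap K$ is open in $K$. A pseudo-metric $d$ satisfies all the axioms of a metric except that the condition $d(x,y)=0\Rightarrow x=y$ is dropped. Given a pseudo-metric space, $x\approx y$ iff $d(x,y)=0$ is an equivalence relation and the quotient $E/\!\approx$ is a metric space. A pseudo-metrizable space is a topological space whose topology comes from some pseudo-metric. A Polish space is a topological space homeomorphic to a separable complete metric space. A space is a pseudo-Polish space if it is homeomorphic to a pseudo-metric space whose quotient under $\approx$ is a Polish space. *)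

theory Defs
  imports "HOL-Analysis.Analysis"
begin
text \<open>
  A preorder on \<open>E\<close> is a relation \<open>r \<subseteq> E \<times> E\<close> with \<^term>\<open>preorder_on E r\<close>; \<open>(x, y) \<in> r\<close> means
  \<open>x \<le> y\<close>. The increasing hull \<open>i(S)\<close> is \<open>r `` S\<close> and the decreasing hull \<open>d(S)\<close> is \<open>r\<inverse> `` S\<close>.
  As \<open>r \<subseteq> E \<times> E\<close>, increasing and decreasing sets are automatically subsets of \<open>E\<close>.
\<close>

definition increasing_set :: "'a rel \<Rightarrow> 'a set \<Rightarrow> bool"
  where "increasing_set r S \<longleftrightarrow> r `` S = S"

definition decreasing_set :: "'a rel \<Rightarrow> 'a set \<Rightarrow> bool"
  where "decreasing_set r S \<longleftrightarrow> r\<inverse> `` S = S"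

definition order_convex :: "'a rel \<Rightarrow> 'a set \<Rightarrow> bool"
  where "order_convex r S \<longleftrightarrow> (\<exists>I D. increasing_set r I \<and> decreasing_set r D \<and> S = I \<inter> D)"

definition semiclosed_preordered_space :: "'a topology \<Rightarrow> 'a rel \<Rightarrow> bool"
  where "semiclosed_preordered_space X r \<longleftrightarrow>
    preorder_on (topspace X) r \<and>
    (\<forall>x \<in> topspace X. closedin X (r `` {x}) \<and> closedin X (r\<inverse> `` {x}))"

definition closed_preordered_space :: "'a topology \<Rightarrow> 'a rel \<Rightarrow> bool"
  where "closed_preordered_space X r \<longleftrightarrow>
    preorder_on (topspace X) r \<and> closedin (prod_topology X X) r"

definition locally_convex_preordered_space :: "'a topology \<Rightarrow> 'a rel \<Rightarrow> bool"
  where "locally_convex_preordered_space X r \<longleftrightarrow>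
    preorder_on (topspace X) r \<and> neighbourhood_base_of (order_convex r) X"

definition k_omega_space :: "'a topology \<Rightarrow> bool"
  where "k_omega_space X \<longleftrightarrow>
    (\<exists>K :: nat \<Rightarrow> 'a set.
       (\<forall>i. compactin X (K i)) \<and> (\<Union>i. K i) = topspace X \<and>
       (\<forall>U. U \<subseteq> topspace X \<longrightarrow>
          (openin X U \<longleftrightarrow> (\<forall>i. openin (subtopology X (K i)) (U \<inter> K i)))))"

definition hemicompact_space :: "'a topology \<Rightarrow> bool"
  where "hemicompact_space X \<longleftrightarrow>
    (\<exists>K :: nat \<Rightarrow> 'a set.
       (\<forall>i. compactin X (K i)) \<and> (\<forall>C. compactin X C \<longrightarrow> (\<exists>i. C \<subseteq> K i)))"

definition pseudometric_on :: "'a set \<Rightarrow> ('a \<Rightarrow> 'a \<Rightarrow> real) \<Rightarrow> bool"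
  where "pseudometric_on M d \<longleftrightarrow>
    (\<forall>x\<in>M. \<forall>y\<in>M. 0 \<le> d x y) \<and>
    (\<forall>x\<in>M. d x x = 0) \<and>
    (\<forall>x\<in>M. \<forall>y\<in>M. d x y = d y x) \<and>
    (\<forall>x\<in>M. \<forall>y\<in>M. \<forall>z\<in>M. d x z \<le> d x y + d y z)"

definition pseudometric_topology :: "'a set \<Rightarrow> ('a \<Rightarrow> 'a \<Rightarrow> real) \<Rightarrow> 'a topology"
  where "pseudometric_topology M d =
    topology (\<lambda>U. U \<subseteq> M \<and> (\<forall>x\<in>U. \<exists>e>0. {y \<in> M. d x y < e} \<subseteq> U))"

lemma openin_pseudometric_topology:
  "openin (pseudometric_topology M d) U \<longleftrightarrow>
     U \<subseteq> M \<and> (\<forall>x\<in>U. \<exists>e>0. {y \<in> M. d x y < e} \<subseteq> U)"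
proof -
  define L where "L = (\<lambda>U. U \<subseteq> M \<and> (\<forall>x\<in>U. \<exists>e>0. {y \<in> M. d x y < e} \<subseteq> U))"
  have "L (S \<inter> T)" if S: "L S" and T: "L T" for S T
    unfolding L_def
  proof (intro conjI ballI)
    show "S \<inter> T \<subseteq> M" using S unfolding L_def by blast
    fix x assume "x \<in> S \<inter> T"
    then obtain a b where "a > 0" "{y \<in> M. d x y < a} \<subseteq> S" "b > 0" "{y \<in> M. d x y < b} \<subseteq> T"
      using S T unfolding L_def by blast
    then show "\<exists>e>0. {y \<in> M. d x y < e} \<subseteq> S \<inter> T"
      by (intro exI[of _ "min a b"]) auto
  qed
  moreover have "L (\<Union>\<K>)" if "\<forall>K\<in>\<K>. L K" for \<K>
    unfolding L_def
  proof (intro conjI ballI)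
    show "\<Union>\<K> \<subseteq> M" using that unfolding L_def by blast
    fix x assume "x \<in> \<Union>\<K>"
    then obtain K where K: "K \<in> \<K>" "x \<in> K" by blast
    then have "L K" using that by blast
    then obtain e where e: "e > 0" "{y \<in> M. d x y < e} \<subseteq> K"
      using K(2) unfolding L_def by meson
    have "{y \<in> M. d x y < e} \<subseteq> \<Union>\<K>"
      using e(2) K(1) by (meson Union_upper subset_trans)
    then show "\<exists>e>0. {y \<in> M. d x y < e} \<subseteq> \<Union>\<K>" using e(1) by blast
  qed
  ultimately have "istopology L"
    unfolding istopology_def by blast
  then have "openin (pseudometric_topology M d) = L"
    unfolding pseudometric_topology_def L_def by (rule topology_inverse')
  then show ?thesis
    by (simp only: L_def)
qed

lemma topspace_pseudometric_topology [simp]: "topspace (pseudometric_topology M d) = M"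
proof
  show "topspace (pseudometric_topology M d) \<subseteq> M"
    using openin_topspace[of "pseudometric_topology M d"]
    unfolding openin_pseudometric_topology by (rule conjunct1)
  have "openin (pseudometric_topology M d) M"
    unfolding openin_pseudometric_topology
    by (intro conjI ballI subset_refl exI[of _ 1] zero_less_one Collect_restrict)
  then show "M \<subseteq> topspace (pseudometric_topology M d)"
    by (rule openin_subset)
qed

lemma (in Metric_space) pseudometric_topology_eq_mtopology:
  "pseudometric_topology M d = mtopology"
proof -
  have "mball x e = {y \<in> M. d x y < e}" if "x \<in> M" for x e
    using that by auto
  then have "openin (pseudometric_topology M d) U \<longleftrightarrow> openin mtopology U" for U
    unfolding openin_pseudometric_topology openin_mtopology by (metis subsetD)
  then show ?thesis by (simp add: topology_eq)
qed

definition pseudometric_rel :: "'a set \<Rightarrow> ('a \<Rightarrow> 'a \<Rightarrow> real) \<Rightarrow> 'a rel"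
  where "pseudometric_rel M d = {(x, y). x \<in> M \<and> y \<in> M \<and> d x y = 0}"

text \<open>
  The distance of two classes is the distance of any representatives. The value \<open>0\<close> off the
  carrier is needed because \<^locale>\<open>Metric_space\<close> requires nonnegativity on the whole type.
\<close>

definition quotient_dist :: "'a set \<Rightarrow> ('a \<Rightarrow> 'a \<Rightarrow> real) \<Rightarrow> 'a set \<Rightarrow> 'a set \<Rightarrow> real"
  where "quotient_dist M d A B =
    (if A \<in> M // pseudometric_rel M d \<and> B \<in> M // pseudometric_rel M d
     then d (SOME a. a \<in> A) (SOME b. b \<in> B) else 0)"

lemma equiv_pseudometric_rel:
  assumes "pseudometric_on M d"
  shows "equiv M (pseudometric_rel M d)"
proof (rule equivI)
  show "pseudometric_rel M d \<subseteq> M \<times> M" "refl_on M (pseudometric_rel M d)"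
    using assms by (auto simp: pseudometric_rel_def pseudometric_on_def refl_on_def)
  show "sym (pseudometric_rel M d)"
    using assms by (auto simp: pseudometric_rel_def pseudometric_on_def sym_def)
  show "trans (pseudometric_rel M d)"
  proof (rule transI)
    fix x y z assume "(x, y) \<in> pseudometric_rel M d" "(y, z) \<in> pseudometric_rel M d"
    then have *: "x \<in> M" "y \<in> M" "z \<in> M" "d x y = 0" "d y z = 0"
      by (auto simp: pseudometric_rel_def)
    then have "d x z \<le> d x y + d y z" "0 \<le> d x z"
      using assms unfolding pseudometric_on_def by blast+
    with * show "(x, z) \<in> pseudometric_rel M d"
      by (auto simp: pseudometric_rel_def)
  qed
qed

lemma quotient_dist_eq:
  assumes d: "pseudometric_on M d"
    and A: "A \<in> M // pseudometric_rel M d" "a \<in> A"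
    and B: "B \<in> M // pseudometric_rel M d" "b \<in> B"
  shows "quotient_dist M d A B = d a b"
proof -
  let ?a = "SOME a. a \<in> A" and ?b = "SOME b. b \<in> B"
  have "?a \<in> A" "?b \<in> B" using A B by (auto intro: someI)
  then have "(?a, a) \<in> pseudometric_rel M d" "(?b, b) \<in> pseudometric_rel M d"
    using A B quotient_eq_iff[OF equiv_pseudometric_rel[OF d]] by blast+
  then have *: "?a \<in> M" "a \<in> M" "?b \<in> M" "b \<in> M" "d ?a a = 0" "d ?b b = 0"
    by (auto simp: pseudometric_rel_def)
  have tri: "d x z \<le> d x y + d y z" and com: "d x y = d y x"
    if "x \<in> M" "y \<in> M" "z \<in> M" for x y z
    using d that unfolding pseudometric_on_def by blast+
  have "d ?a ?b \<le> d ?a a + d a ?b" "d a ?b \<le> d a b + d b ?b"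
    "d a b \<le> d a ?a + d ?a b" "d ?a b \<le> d ?a ?b + d ?b b"
    using * tri by blast+
  moreover have "d b ?b = 0" "d a ?a = 0"
    using * com by metis+
  ultimately have "d ?a ?b = d a b" using * by linarith
  then show ?thesis using A B by (simp add: quotient_dist_def)
qed

lemma Metric_space_quotient_dist:
  assumes d: "pseudometric_on M d"
  shows "Metric_space (M // pseudometric_rel M d) (quotient_dist M d)"
proof -
  let ?Q = "M // pseudometric_rel M d"
  note eq = equiv_pseudometric_rel[OF d]
  have rep: "\<exists>a. a \<in> A \<and> a \<in> M" if "A \<in> ?Q" for A
    using that in_quotient_imp_non_empty[OF eq that] in_quotient_imp_subset[OF eq that] by blast
  show ?thesis
  proof
    fix A B
    show "0 \<le> quotient_dist M d A B"
    proof (cases "A \<in> ?Q \<and> B \<in> ?Q")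
      case True
      then obtain a b where "a \<in> A" "a \<in> M" "b \<in> B" "b \<in> M" using rep by meson
      then show ?thesis
        using True quotient_dist_eq[OF d] d by (simp add: pseudometric_on_def)
    qed (auto simp: quotient_dist_def)
    show "quotient_dist M d A B = quotient_dist M d B A"
    proof (cases "A \<in> ?Q \<and> B \<in> ?Q")
      case True
      then obtain a b where "a \<in> A" "a \<in> M" "b \<in> B" "b \<in> M" using rep by meson
      then show ?thesis
        using True quotient_dist_eq[OF d] d by (simp add: pseudometric_on_def)
    qed (auto simp: quotient_dist_def)
  next
    fix A B assume AB: "A \<in> ?Q" "B \<in> ?Q"
    then obtain a b where ab: "a \<in> A" "a \<in> M" "b \<in> B" "b \<in> M" using rep by meson
    have "quotient_dist M d A B = 0 \<longleftrightarrow> (a, b) \<in> pseudometric_rel M d"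
      using AB ab quotient_dist_eq[OF d] by (simp add: pseudometric_rel_def)
    also have "\<dots> \<longleftrightarrow> A = B"
      using quotient_eq_iff[OF eq AB ab(1,3)] by simp
    finally show "quotient_dist M d A B = 0 \<longleftrightarrow> A = B" .
  next
    fix A B C assume ABC: "A \<in> ?Q" "B \<in> ?Q" "C \<in> ?Q"
    then obtain a b c where "a \<in> A" "a \<in> M" "b \<in> B" "b \<in> M" "c \<in> C" "c \<in> M" using rep by meson
    then show "quotient_dist M d A C \<le> quotient_dist M d A B + quotient_dist M d B C"
      using ABC quotient_dist_eq[OF d] d by (simp add: pseudometric_on_def)
  qed
qed

text \<open>
  In the next three definitions the (pseudo-)metric space is sought on a subset of the type of the
  points of \<open>X\<close>. This is no restriction, since a (pseudo-)metric can be transported along a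
  homeomorphism to the carrier of \<open>X\<close>.
\<close>

definition pseudo_metrizable_space :: "'a topology \<Rightarrow> bool"
  where "pseudo_metrizable_space X \<longleftrightarrow>
    (\<exists>M d. pseudometric_on M d \<and> X = pseudometric_topology M d)"

definition Polish_space :: "'a topology \<Rightarrow> bool"
  where "Polish_space X \<longleftrightarrow>
    (\<exists>(M :: 'a set) d. Metric_space M d \<and> Metric_space.mcomplete M d \<and>
       separable_space (Metric_space.mtopology M d) \<and>
       X homeomorphic_space Metric_space.mtopology M d)"

definition pseudo_Polish_space :: "'a topology \<Rightarrow> bool"
  where "pseudo_Polish_space X \<longleftrightarrow>
    (\<exists>(M :: 'a set) d. pseudometric_on M d \<and>
       X homeomorphic_space pseudometric_topology M d \<and>
       Polish_space
         (Metric_space.mtopology (M // pseudometric_rel M d) (quotient_dist M d)))"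

end

theory Submission
  imports Defs
begin

text \<open>
  Local convexity makes the classes of the equivalence relation \<open>x \<le> y \<le> x\<close> topologically
  indistinguishable. Hence a locally convex semiclosed preordered space satisfies the separation
  axiom \<open>R\<^sub>0\<close>, and a locally convex closed one satisfies \<open>R\<^sub>1\<close>, and the order can be forgotten:
  in an \<open>R\<^sub>0\<close> first-countable \<open>k\<^sub>\<omega>\<close>-space, a sequence witnessing failure of local compactness at
  its limit would have a closed tail; and a locally compact \<open>R\<^sub>1\<close> space is regular, so that
  Urysohn functions indexed by pairs of basic open sets map it to \<open>\<real>\<^sup>\<nat>\<close>, whose metric pulls back
  to a pseudo-metric for the topology. A pseudo-metric topology is the pullback of the topology of its
  metric quotient along an open map, which carries local compactness, second countability and
  hence complete metrizability down to the quotient, and second countability back up.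
\<close>

subsection \<open>Pseudo-metric topologies as pullbacks\<close>

lemma pseudo_metrizable_spaceI:
  "pseudometric_on M d \<Longrightarrow> X = pseudometric_topology M d \<Longrightarrow> pseudo_metrizable_space X"
  unfolding pseudo_metrizable_space_def by blast

lemma openin_pseudometric_ball:
  assumes "pseudometric_on M d" "x \<in> M"
  shows "openin (pseudometric_topology M d) {y \<in> M. d x y < e}"
  unfolding openin_pseudometric_topology
proof (intro conjI ballI)
  fix y assume y: "y \<in> {y \<in> M. d x y < e}"
  have "{z \<in> M. d y z < e - d x y} \<subseteq> {z \<in> M. d x z < e}"
  proof clarify
    fix z assume "z \<in> M" "d y z < e - d x y"
    moreover have "d x z \<le> d x y + d y z"
      using assms y \<open>z \<in> M\<close> unfolding pseudometric_on_def by blast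
    ultimately show "d x z < e" by linarith
  qed
  then show "\<exists>e'>0. {z \<in> M. d y z < e'} \<subseteq> {y \<in> M. d x y < e}"
    using y by (intro exI[of _ "e - d x y"]) auto
qed auto

lemma (in Metric_space) pseudometric_on: "pseudometric_on M d"
  unfolding pseudometric_on_def using nonneg mdist_zero commute triangle by blast

text \<open>The balls of radius \<open>inverse (Suc n)\<close> about points of \<open>C\<close> form
  a base: within an \<open>e\<close>-ball about \<open>x\<close>, take a radius below
  \<open>e/2\<close> and a centre closer to \<open>x\<close> than that radius.\<close>

lemma second_countable_pseudometric:
  assumes d: "pseudometric_on M d" and C: "countable C" "C \<subseteq> M"
    and dense: "\<And>x e. x \<in> M \<Longrightarrow> e > 0 \<Longrightarrow> \<exists>c\<in>C. d x c < e"
  shows "second_countable (pseudometric_topology M d)"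
proof -
  define \<B> where "\<B> = (\<lambda>(c, n :: nat). {y \<in> M. d c y < inverse (Suc n)}) ` (C \<times> UNIV)"
  have "countable \<B>" unfolding \<B>_def using C by simp
  moreover have "openin (pseudometric_topology M d) V" if "V \<in> \<B>" for V
    using that openin_pseudometric_ball[OF d] C unfolding \<B>_def by auto
  moreover have "\<exists>V\<in>\<B>. x \<in> V \<and> V \<subseteq> U" if U: "openin (pseudometric_topology M d) U" "x \<in> U" for U x
  proof -
    obtain e where e: "e > 0" "{y \<in> M. d x y < e} \<subseteq> U" "x \<in> M"
      using U unfolding openin_pseudometric_topology by blast
    obtain n where n: "inverse (real (Suc n)) < e / 2"
      using e(1) reals_Archimedean[of "e/2"] by auto
    obtain c where c: "c \<in> C" "d x c < inverse (Suc n)"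
      using dense[OF e(3), of "inverse (Suc n)"] by auto
    have cx: "d c x = d x c" using d C c e unfolding pseudometric_on_def by blast
    have "{y \<in> M. d c y < inverse (Suc n)} \<subseteq> {y \<in> M. d x y < e}"
    proof clarify
      fix y assume "y \<in> M" "d c y < inverse (Suc n)"
      moreover have "d x y \<le> d x c + d c y"
        using d C c e \<open>y \<in> M\<close> unfolding pseudometric_on_def by blast
      ultimately show "d x y < e" using c n by linarith
    qed
    then show ?thesis using e c cx unfolding \<B>_def
      by (intro bexI[of _ "{y \<in> M. d c y < inverse (Suc n)}"]) auto
  qed
  ultimately show ?thesis unfolding second_countable_def by (intro exI[of _ \<B>]) simp
qed

lemma second_countable_separable_mtopology:
  assumes M: "Metric_space M d" and sep: "separable_space (Metric_space.mtopology M d)"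
  shows "second_countable (Metric_space.mtopology M d)"
proof -
  interpret Metric_space M d by fact
  obtain C where C: "countable C" "C \<subseteq> M" "mtopology closure_of C = M"
    using sep unfolding separable_space_def by auto
  have "\<exists>c\<in>C. d x c < e" if "x \<in> M" "e > 0" for x e
    using that C(3) unfolding metric_closure_of by auto
  then have "second_countable (pseudometric_topology M d)"
    using second_countable_pseudometric[OF pseudometric_on C(1,2)] by blast
  then show ?thesis by (simp add: pseudometric_topology_eq_mtopology)
qed

text \<open>Each \<open>K i\<close> is totally bounded; its finite nets, taken for all
  \<open>i\<close> and all radii \<open>inverse (Suc n)\<close>, together form a countable dense
  set.\<close>

lemma second_countable_pseudometric_sigma_compact:
  assumes d: "pseudometric_on M d" and K: "\<And>i :: nat. compactin (pseudometric_topology M d) (K i)"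
    and cover: "M \<subseteq> (\<Union>i. K i)"
  shows "second_countable (pseudometric_topology M d)"
proof -
  let ?X = "pseudometric_topology M d"
  have KM: "K i \<subseteq> M" for i
    using K[of i] compactin_subset_topspace by fastforce
  have "\<exists>F. finite F \<and> F \<subseteq> K i \<and> K i \<subseteq> (\<Union>c\<in>F. {y \<in> M. d c y < inverse (Suc n)})" for i n :: nat
  proof -
    let ?b = "\<lambda>c. {y \<in> M. d c y < inverse (Suc n)}"
    have "\<exists>\<F>. finite \<F> \<and> \<F> \<subseteq> ?b ` K i \<and> K i \<subseteq> \<Union>\<F>"
    proof (rule compactinD[OF K])
      show "openin ?X U" if "U \<in> ?b ` K i" for U
        using that KM[of i] by (auto intro!: openin_pseudometric_ball[OF d])
      show "K i \<subseteq> \<Union>(?b ` K i)"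
      proof
        fix x assume x: "x \<in> K i"
        then have "x \<in> M" using KM by blast
        then have "d x x = 0" using d unfolding pseudometric_on_def by blast
        then have "x \<in> ?b x" using \<open>x \<in> M\<close> by simp
        with x show "x \<in> \<Union>(?b ` K i)" by blast
      qed
    qed
    then show ?thesis by (metis (no_types, lifting) finite_subset_image)
  qed
  then have "\<exists>F. \<forall>i n. finite (F i n) \<and> F i n \<subseteq> K i \<and>
      K i \<subseteq> (\<Union>c\<in>F i n. {y \<in> M. d c y < inverse (Suc n)})"
    by (intro choice allI)
  then obtain F where F: "\<forall>i n. finite (F i n) \<and> F i n \<subseteq> K i \<and>
      K i \<subseteq> (\<Union>c\<in>F i n. {y \<in> M. d c y < inverse (Suc n)})"
    by (elim exE)
  have F: "finite (F i n)" "F i n \<subseteq> K i"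
    "K i \<subseteq> (\<Union>c\<in>F i n. {y \<in> M. d c y < inverse (Suc n)})" for i n
    using F[rule_format, of i n] by simp_all
  define C where "C = (\<Union>i n. F i n)"
  show ?thesis
  proof (rule second_countable_pseudometric[OF d])
    show "countable C" unfolding C_def using F(1) by (simp add: countable_finite)
    show "C \<subseteq> M" unfolding C_def using F(2) KM by blast
    fix x and e :: real assume xe: "x \<in> M" "e > 0"
    obtain n where n: "inverse (real (Suc n)) < e"
      using xe reals_Archimedean by blast
    obtain i where "x \<in> K i" using xe cover by blast
    then obtain c where c: "c \<in> F i n" "d c x < inverse (Suc n)" using F(3)[of i n] by auto
    then have "c \<in> M" using F(2) KM by blast
    then have "d x c = d c x" using d xe unfolding pseudometric_on_def by blast
    with c n show "\<exists>c\<in>C. d x c < e" unfolding C_def by force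
  qed
qed

text \<open>Balls for the distance \<open>d (f x) (f y)\<close> are preimages of balls about image
  points, so a pseudo-metric moves to any set mapped into \<open>M\<close>.\<close>

lemma pullback_pseudometric_topology:
  assumes d: "pseudometric_on M d" and f: "f ` S \<subseteq> M"
  shows "pullback_topology S f (pseudometric_topology M d)
       = pseudometric_topology S (\<lambda>x y. d (f x) (f y))"
proof (rule topology_eq[THEN iffD2], intro allI iffI)
  fix U assume "openin (pullback_topology S f (pseudometric_topology M d)) U"
  then obtain V where V: "openin (pseudometric_topology M d) V" "U = f -` V \<inter> S"
    unfolding openin_pullback_topology by blast
  show "openin (pseudometric_topology S (\<lambda>x y. d (f x) (f y))) U"
    unfolding openin_pseudometric_topology
  proof (intro conjI ballI)
    fix x assume "x \<in> U"
    then obtain e where "e > 0" "{y \<in> M. d (f x) y < e} \<subseteq> V"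
      using V unfolding openin_pseudometric_topology by blast
    then show "\<exists>e>0. {y \<in> S. d (f x) (f y) < e} \<subseteq> U"
      using V(2) f by blast
  qed (use V in auto)
next
  fix U assume "openin (pseudometric_topology S (\<lambda>x y. d (f x) (f y))) U"
  then have U: "U \<subseteq> S" "\<forall>x\<in>U. \<exists>e>0. {y \<in> S. d (f x) (f y) < e} \<subseteq> U"
    unfolding openin_pseudometric_topology by auto
  then obtain e where e: "\<And>x. x \<in> U \<Longrightarrow> e x > 0" "\<And>x. x \<in> U \<Longrightarrow> {y \<in> S. d (f x) (f y) < e x} \<subseteq> U"
    by metis
  \<comment> \<open>The radii that work for the points of \<open>U\<close> are reused for balls
    about their images; the preimage of this union is exactly \<open>U\<close>.\<close>
  let ?V = "\<Union>x\<in>U. {y \<in> M. d (f x) y < e x}"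
  have "openin (pseudometric_topology M d) ?V"
    using f U(1) by (intro openin_Union) (auto intro!: openin_pseudometric_ball[OF d])
  moreover have "U = f -` ?V \<inter> S"
  proof
    have "d (f x) (f x) = 0" if "x \<in> U" for x
      using that d f U(1) unfolding pseudometric_on_def by blast
    then show "U \<subseteq> f -` ?V \<inter> S" using e(1) U(1) f by force
    show "f -` ?V \<inter> S \<subseteq> U" using e(2) by auto
  qed
  ultimately show "openin (pullback_topology S f (pseudometric_topology M d)) U"
    unfolding openin_pullback_topology by blast
qed

lemma pseudo_metrizable_space_pullback:
  assumes "pseudometric_on M d" "f ` S \<subseteq> M"
  shows "pseudo_metrizable_space (pullback_topology S f (pseudometric_topology M d))"
proof (rule pseudo_metrizable_spaceI)
  show "pseudometric_on S (\<lambda>x y. d (f x) (f y))"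
    using assms unfolding pseudometric_on_def image_subset_iff by (smt (verit, ccfv_threshold))
qed (rule pullback_pseudometric_topology[OF assms])

text \<open>Injectivity makes an open set the preimage of its open image. This allows a
  pseudo-metric on a homeomorphic copy to be pulled back to the carrier of \<open>X\<close>.\<close>

lemma homeomorphic_map_imp_pullback_topology:
  assumes "homeomorphic_map X Y f"
  shows "X = pullback_topology (topspace X) f Y"
proof (rule topology_eq[THEN iffD2], intro allI iffI)
  fix U assume U: "openin X U"
  have "openin Y (f ` U)" using U assms homeomorphic_map_openness_eq by blast
  moreover have "U = f -` f ` U \<inter> topspace X"
    using assms openin_subset[OF U] homeomorphic_imp_injective_map[OF assms]
    by (auto simp: inj_on_def subset_iff)
  ultimately show "openin (pullback_topology (topspace X) f Y) U"
    unfolding openin_pullback_topology by blast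
next
  fix U assume "openin (pullback_topology (topspace X) f Y) U"
  then obtain V where V: "openin Y V" "U = {x \<in> topspace X. f x \<in> V}"
    unfolding openin_pullback_topology by blast
  then show "openin X U"
    using homeomorphic_imp_continuous_map[OF assms] openin_continuous_map_preimage by blast
qed

lemma second_countable_pullback_topology:
  assumes "second_countable Y"
  shows "second_countable (pullback_topology S f Y)"
proof -
  obtain \<B> where \<B>: "countable \<B>" "\<And>V. V \<in> \<B> \<Longrightarrow> openin Y V"
    "\<And>U x. openin Y U \<Longrightarrow> x \<in> U \<Longrightarrow> \<exists>V\<in>\<B>. x \<in> V \<and> V \<subseteq> U"
    using assms unfolding second_countable_def by metis
  let ?\<C> = "(\<lambda>V. f -` V \<inter> S) ` \<B>"
  have "\<exists>V\<in>?\<C>. x \<in> V \<and> V \<subseteq> U" if U: "openin (pullback_topology S f Y) U" "x \<in> U" for U x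
  proof -
    obtain W where W: "openin Y W" "U = f -` W \<inter> S"
      using U unfolding openin_pullback_topology by blast
    then obtain V where "V \<in> \<B>" "f x \<in> V" "V \<subseteq> W" using \<B>(3)[of W "f x"] U by blast
    then show ?thesis
      using W U by (intro bexI[of _ "f -` V \<inter> S"] imageI) auto
  qed
  moreover have "countable ?\<C>" using \<B>(1) by simp
  moreover have "\<forall>V\<in>?\<C>. openin (pullback_topology S f Y) V"
    using \<B>(2) by (auto simp: openin_pullback_topology)
  ultimately show ?thesis unfolding second_countable_def by (intro exI[of _ ?\<C>]) simp
qed

text \<open>By surjectivity the image of the preimage of \<open>V\<close> is \<open>V\<close>
  itself. Applied to the class map, this lets topological properties descend to the metric
  quotient.\<close>

lemma continuous_open_map_pullback_topology:
  assumes "f ` S = topspace Y"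
  shows "continuous_map (pullback_topology S f Y) Y f" "open_map (pullback_topology S f Y) Y f"
proof -
  show "continuous_map (pullback_topology S f Y) Y f"
    using continuous_map_pullback[of Y Y id S f] by simp
  show "open_map (pullback_topology S f Y) Y f"
    unfolding open_map_def openin_pullback_topology
  proof clarify
    fix V assume V: "openin Y V"
    have "f ` (f -` V \<inter> S) = V \<inter> f ` S" by auto
    also have "\<dots> = V" using assms openin_subset[OF V] by auto
    finally show "openin Y (f ` (f -` V \<inter> S))" using V by simp
  qed
qed

text \<open>The class map preserves distances, since the quotient distance may be computed on any
  representatives; hence both topologies have the same balls.\<close>

lemma pseudometric_topology_eq_pullback_quotient:
  assumes d: "pseudometric_on M d"
  defines "Q \<equiv> M // pseudometric_rel M d"
  shows "pseudometric_topology M d =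
    pullback_topology M (\<lambda>x. pseudometric_rel M d `` {x}) (Metric_space.mtopology Q (quotient_dist M d))"
proof -
  let ?c = "\<lambda>x. pseudometric_rel M d `` {x}"
  interpret Q: Metric_space Q "quotient_dist M d"
    unfolding Q_def by (rule Metric_space_quotient_dist[OF d])
  note eqv = equiv_pseudometric_rel[OF d]
  have c: "?c x \<in> Q" "x \<in> ?c x" if "x \<in> M" for x
    using that equiv_class_self[OF eqv that] unfolding Q_def by (auto intro: quotientI)
  have "quotient_dist M d (?c x) (?c y) = d x y" if "x \<in> M" "y \<in> M" for x y
    using that c quotient_dist_eq[OF d] unfolding Q_def by blast
  then have "{y \<in> M. d x y < e} = {y \<in> M. quotient_dist M d (?c x) (?c y) < e}" if "x \<in> M" for x e
    using that by auto
  then have "pseudometric_topology M d = pseudometric_topology M (\<lambda>x y. quotient_dist M d (?c x) (?c y))"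
    unfolding topology_eq openin_pseudometric_topology
    by (intro allI conj_cong ball_cong refl) (drule (1) subsetD, simp)
  also have "\<dots> = pullback_topology M ?c (pseudometric_topology Q (quotient_dist M d))"
    using c by (intro pullback_pseudometric_topology[symmetric] Q.pseudometric_on) auto
  finally show ?thesis by (simp only: Q.pseudometric_topology_eq_mtopology)
qed

subsection \<open>Separation axioms \<open>R\<^sub>0\<close> and \<open>R\<^sub>1\<close>\<close>

text \<open>Symmetry of the specialization preorder.\<close>

definition r0_space :: "'a topology \<Rightarrow> bool"
  where "r0_space X \<longleftrightarrow> (\<forall>x\<in>topspace X. \<forall>y. y \<in> X closure_of {x} \<longrightarrow> x \<in> X closure_of {y})"

text \<open>Topologically distinguishable points have disjoint neighbourhoods. The one-sided
  condition covers both directions because \<open>x\<close> and \<open>y\<close> range over all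
  ordered pairs.\<close>

definition r1_space :: "'a topology \<Rightarrow> bool"
  where "r1_space X \<longleftrightarrow> (\<forall>x\<in>topspace X. \<forall>y\<in>topspace X. y \<notin> X closure_of {x} \<longrightarrow>
    (\<exists>U V. openin X U \<and> openin X V \<and> x \<in> U \<and> y \<in> V \<and> disjnt U V))"

lemma in_closure_of_singleton:
  "y \<in> X closure_of {x} \<longleftrightarrow> y \<in> topspace X \<and> (\<forall>U. openin X U \<and> y \<in> U \<longrightarrow> x \<in> U)"
  by (auto simp: in_closure_of)

text \<open>The form in which symmetry is applied: if \<open>y\<close> is in the closure of
  \<open>x\<close>, then \<open>x\<close> is in the closure of \<open>y\<close>, so every open set
  around \<open>x\<close> contains \<open>y\<close>.\<close>

lemma r0_space_openin_closure_of:
  assumes "r0_space X" "openin X U" "x \<in> U"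
  shows "X closure_of {x} \<subseteq> U"
proof
  fix y assume "y \<in> X closure_of {x}"
  then have "x \<in> X closure_of {y}"
    using assms openin_subset unfolding r0_space_def by blast
  then show "y \<in> U" using assms(2,3) unfolding in_closure_of_singleton by blast
qed

lemma r1_imp_r0_space:
  assumes "r1_space X"
  shows "r0_space X"
  unfolding r0_space_def
proof (intro ballI allI impI)
  fix x y assume x: "x \<in> topspace X" and y: "y \<in> X closure_of {x}"
  have "y \<in> topspace X" using y by (simp add: in_closure_of)
  show "x \<in> X closure_of {y}"
  proof (rule ccontr)
    assume "x \<notin> X closure_of {y}"
    then obtain U V where "openin X U" "openin X V" "y \<in> U" "x \<in> V" "disjnt U V"
      using assms x \<open>y \<in> topspace X\<close> unfolding r1_space_def by meson
    with y show False unfolding in_closure_of_singleton disjnt_def by blast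
  qed
qed

text \<open>The usual finite-subcover argument for Hausdorff spaces, with
  \<open>x \<notin> X closure_of {k}\<close> in place of \<open>x \<noteq> k\<close>.\<close>

lemma r1_space_point_compact_separation:
  assumes X: "r1_space X" and x: "x \<in> topspace X" and K: "compactin X K"
    and disj: "\<And>k. k \<in> K \<Longrightarrow> x \<notin> X closure_of {k}"
  obtains U V where "openin X U" "openin X V" "x \<in> U" "K \<subseteq> V" "disjnt U V"
proof -
  have KX: "K \<subseteq> topspace X" using K by (rule compactin_subset_topspace)
  have "\<forall>k\<in>K. \<exists>U V. openin X U \<and> openin X V \<and> x \<in> U \<and> k \<in> V \<and> disjnt U V"
    using X x KX disj unfolding r1_space_def by (metis disjnt_sym subsetD)
  then obtain U V where UV: "\<And>k. k \<in> K \<Longrightarrow> openin X (U k) \<and> openin X (V k) \<and> x \<in> U k \<and> k \<in> V k \<and> disjnt (U k) (V k)"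
    by metis
  have "\<exists>\<F>. finite \<F> \<and> \<F> \<subseteq> V ` K \<and> K \<subseteq> \<Union>\<F>"
    by (rule compactinD[OF K]) (use UV in auto)
  then obtain F where F: "finite F" "F \<subseteq> K" "K \<subseteq> \<Union>(V ` F)"
    by (metis finite_subset_image)
  \<comment> \<open>Intersecting with \<open>topspace X\<close> keeps the set open when
    \<open>F\<close> is empty, where the intersection over \<open>F\<close> would be the whole
    type.\<close>
  let ?U = "topspace X \<inter> (\<Inter>k\<in>F. U k)"
  show thesis
  proof
    show "openin X ?U"
    proof (cases "F = {}")
      case False
      have "openin X (\<Inter>(U ` F))"
        using F UV False by (intro openin_Inter) auto
      then show ?thesis by (simp add: openin_Int)
    qed simp
    show "openin X (\<Union>(V ` F))" using F UV by (intro openin_Union) auto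
    show "x \<in> ?U" using x F UV by auto
    show "disjnt ?U (\<Union>(V ` F))"
      using F(2) UV unfolding disjnt_def by blast
  qed (rule F(3))
qed

text \<open>A point outside all closures of points of \<open>K\<close> has a neighbourhood disjoint
  from \<open>K\<close>, by the separation above. So the closure of a compact set is covered by its
  point closures.\<close>

lemma r1_space_closure_of_compactin:
  assumes X: "r1_space X" and K: "compactin X K" and x: "x \<in> X closure_of K"
  obtains k where "k \<in> K" "x \<in> X closure_of {k}"
proof (rule ccontr)
  assume "\<not> thesis"
  then have n: "\<And>k. k \<in> K \<Longrightarrow> x \<notin> X closure_of {k}" using that by blast
  have "x \<in> topspace X" using x by (simp add: in_closure_of)
  then obtain U V where "openin X U" "openin X V" "x \<in> U" "K \<subseteq> V" "disjnt U V"
    by (rule r1_space_point_compact_separation[OF X _ K n])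
  with x show False unfolding in_closure_of disjnt_def by blast
qed

text \<open>Separate \<open>x\<close> from the compact part of \<open>K\<close> outside
  \<open>W \<inter> N\<close> and shrink the neighbourhood accordingly. Compact sets need not be
  closed here, so a point of the closure is traced back to some \<open>k\<close> in \<open>K\<close>
  whose closure contains it, and open sets containing \<open>k\<close> contain that point as
  well.\<close>

lemma locally_compact_r1_imp_regular_space:
  assumes lc: "locally_compact_space X" and X: "r1_space X"
  shows "regular_space X"
  unfolding neighbourhood_base_of_closedin[symmetric] neighbourhood_base_of
proof (intro allI impI, elim conjE)
  fix W x assume W: "openin X W" "x \<in> W"
  have r0: "r0_space X" by (rule r1_imp_r0_space[OF X])
  have x: "x \<in> topspace X" using W openin_subset by blast
  then obtain N K where N: "openin X N" "compactin X K" "x \<in> N" "N \<subseteq> K"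
    using lc unfolding locally_compact_space_def by blast
  have KX: "K \<subseteq> topspace X" using N(2) by (rule compactin_subset_topspace)
  have "compactin X ((topspace X - (W \<inter> N)) \<inter> K)"
    using N W by (intro closed_Int_compactin) auto
  moreover have "x \<notin> X closure_of {k}" if "k \<in> (topspace X - (W \<inter> N)) \<inter> K" for k
    using that x W N unfolding in_closure_of_singleton by blast
  ultimately obtain A B where AB: "openin X A" "openin X B" "x \<in> A"
      "(topspace X - (W \<inter> N)) \<inter> K \<subseteq> B" "disjnt A B"
    by (rule r1_space_point_compact_separation[OF X x])
  let ?V = "A \<inter> W \<inter> N"
  have "X closure_of ?V \<subseteq> W"
  proof
    fix z assume z: "z \<in> X closure_of ?V"
    have "?V \<subseteq> K" using N by blast
    then have "z \<in> X closure_of K" using z closure_of_mono by blast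
    then obtain k where k: "k \<in> K" "z \<in> X closure_of {k}"
      using r1_space_closure_of_compactin[OF X N(2)] by blast
    show "z \<in> W"
    proof (rule ccontr)
      assume "z \<notin> W"
      then have "k \<notin> W" using r0_space_openin_closure_of[OF r0 W(1)] k by blast
      then have "k \<in> B" using AB(4) k KX by blast
      then have "z \<in> B" using r0_space_openin_closure_of[OF r0 AB(2)] k by blast
      then show False using z AB(2,5) unfolding in_closure_of disjnt_def by blast
    qed
  qed
  moreover have "openin X ?V" "x \<in> ?V" using AB(1,3) N(1,3) W by auto
  moreover have "?V \<subseteq> X closure_of ?V"
    using openin_subset[OF W(1)] by (intro closure_of_subset) auto
  ultimately show "\<exists>U V. openin X U \<and> closedin X V \<and> x \<in> U \<and> U \<subseteq> V \<and> V \<subseteq> W"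
    using closedin_closure_of by blast
qed

subsection \<open>Local compactness and countability\<close>

lemma first_countable_decseq_base:
  assumes "first_countable X" "x \<in> topspace X"
  obtains U :: "nat \<Rightarrow> 'a set" where "\<And>n. openin X (U n)" "\<And>n. x \<in> U n" "decseq U"
    "\<And>W. openin X W \<Longrightarrow> x \<in> W \<Longrightarrow> \<exists>n. U n \<subseteq> W"
proof -
  obtain \<B> where \<B>: "countable \<B>" "\<And>V. V \<in> \<B> \<Longrightarrow> openin X V"
     "\<And>W. openin X W \<Longrightarrow> x \<in> W \<Longrightarrow> \<exists>V\<in>\<B>. x \<in> V \<and> V \<subseteq> W"
    using assms unfolding first_countable_def by metis
  define \<C> where "\<C> = {V \<in> \<B>. x \<in> V}"
  have C: "countable \<C>" "\<C> \<noteq> {}"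
    unfolding \<C>_def using \<B>(1) \<B>(3)[OF openin_topspace assms(2)] by auto
  define U where "U n = (\<Inter>i\<le>n. from_nat_into \<C> i)" for n :: nat
  have inC: "from_nat_into \<C> i \<in> \<C>" for i using C by (simp add: from_nat_into)
  show thesis
  proof
    fix n
    show "openin X (U n)" unfolding U_def
      using inC \<B>(2) by (intro openin_Inter) (auto simp: \<C>_def)
    show "x \<in> U n" unfolding U_def using inC by (auto simp: \<C>_def)
    show "decseq U" unfolding U_def decseq_def by fastforce
  next
    fix W assume "openin X W" "x \<in> W"
    then obtain V where V: "V \<in> \<C>" "V \<subseteq> W" using \<B>(3) unfolding \<C>_def by blast
    then obtain n where "from_nat_into \<C> n = V"
      using from_nat_into_surj[OF C(1)] by blast
    then have "U n \<subseteq> W" unfolding U_def using V by blast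
    then show "\<exists>n. U n \<subseteq> W" ..
  qed
qed

text \<open>If \<open>x\<close> has no compact neighbourhood, no member \<open>U n\<close> of a
  decreasing base at \<open>x\<close> lies in \<open>K n\<close>. Points chosen in
  \<open>U n - K n\<close> then converge to \<open>x\<close>, so it suffices to exclude such
  sequences.\<close>

lemma first_countable_locally_compactI:
  fixes K :: "nat \<Rightarrow> 'a set"
  assumes X: "first_countable X" and K: "\<And>n. compactin X (K n)"
    and seq: "\<And>x \<sigma>. limitin X \<sigma> x sequentially \<Longrightarrow> \<forall>n. \<sigma> n \<in> topspace X - K n \<Longrightarrow> False"
  shows "locally_compact_space X"
  unfolding locally_compact_space_def
proof (rule ballI, rule ccontr)
  fix x assume x: "x \<in> topspace X"
    and no: "\<nexists>U K. openin X U \<and> compactin X K \<and> x \<in> U \<and> U \<subseteq> K"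
  obtain U :: "nat \<Rightarrow> 'a set" where U: "\<And>n. openin X (U n)" "\<And>n. x \<in> U n" "decseq U"
    "\<And>W. openin X W \<Longrightarrow> x \<in> W \<Longrightarrow> \<exists>n. U n \<subseteq> W"
    using first_countable_decseq_base[OF X x] by blast
  have "\<not> U n \<subseteq> K n" for n using no K[of n] U(1,2)[of n] by blast
  then have "\<forall>n. \<exists>y. y \<in> U n - K n" by blast
  then obtain \<sigma> where \<sigma>: "\<And>n. \<sigma> n \<in> U n - K n" by metis
  have "limitin X \<sigma> x sequentially"
    unfolding limitin_sequentially
  proof (intro conjI allI impI x, elim conjE)
    fix W assume "openin X W" "x \<in> W"
    then obtain N where N: "U N \<subseteq> W" using U(4) by blast
    have "\<sigma> n \<in> W" if "N \<le> n" for n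
      using \<sigma>[of n] decseqD[OF U(3) that] N by blast
    then show "\<exists>N. \<forall>n\<ge>N. \<sigma> n \<in> W" by blast
  qed
  moreover have "\<forall>n. \<sigma> n \<in> topspace X - K n"
    using \<sigma> U(1) openin_subset by blast
  ultimately show False by (rule seq)
qed

text \<open>A convergent sequence together with its limit is compact, hence contained in one
  \<open>K i\<close>, which its \<open>i\<close>-th term was chosen to avoid.\<close>

lemma hemicompact_first_countable_imp_locally_compact_space:
  assumes "hemicompact_space X" "first_countable X"
  shows "locally_compact_space X"
proof -
  obtain K :: "nat \<Rightarrow> 'a set" where K: "\<And>i. compactin X (K i)" "\<And>C. compactin X C \<Longrightarrow> \<exists>i. C \<subseteq> K i"
    using assms(1) unfolding hemicompact_space_def by blast
  show ?thesis
  proof (rule first_countable_locally_compactI[OF assms(2) K(1)])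
    fix x \<sigma> assume lim: "limitin X \<sigma> x sequentially" and \<sigma>: "\<forall>n. \<sigma> n \<in> topspace X - K n"
    have "compactin X (insert x (range \<sigma>))"
      using \<sigma> by (intro compactin_sequence_with_limit[OF lim]) auto
    then obtain i where "insert x (range \<sigma>) \<subseteq> K i" using K(2) by blast
    then show False using \<sigma> by blast
  qed
qed

text \<open>Under \<open>R0\<close> an open set covering \<open>K\<close> already contains the
  closures of its points, so a finite subcover for \<open>K\<close> also covers the
  saturation.\<close>

lemma compactin_r0_saturation:
  assumes X: "r0_space X" and K: "compactin X K"
  shows "compactin X (\<Union>x\<in>K. X closure_of {x})"
  unfolding compactin_def
proof (intro conjI allI impI)
  show "(\<Union>x\<in>K. X closure_of {x}) \<subseteq> topspace X"
    by (intro UN_least closure_of_subset_topspace)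
  fix \<U> assume \<U>: "Ball \<U> (openin X) \<and> (\<Union>x\<in>K. X closure_of {x}) \<subseteq> \<Union>\<U>"
  have "K \<subseteq> (\<Union>x\<in>K. X closure_of {x})"
    using compactin_subset_topspace[OF K] by (force simp: in_closure_of)
  then have "\<exists>\<F>. finite \<F> \<and> \<F> \<subseteq> \<U> \<and> K \<subseteq> \<Union>\<F>"
    using \<U> by (intro compactinD[OF K]) auto
  then obtain \<F> where \<F>: "finite \<F>" "\<F> \<subseteq> \<U>" "K \<subseteq> \<Union>\<F>" by blast
  have "openin X (\<Union>\<F>)" using \<F>(2) \<U> by blast
  then have "(\<Union>x\<in>K. X closure_of {x}) \<subseteq> \<Union>\<F>"
    using \<F>(3) by (intro UN_least r0_space_openin_closure_of[OF X]) auto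
  with \<F>(1,2) show "\<exists>\<F>. finite \<F> \<and> \<F> \<subseteq> \<U> \<and> (\<Union>x\<in>K. X closure_of {x}) \<subseteq> \<Union>\<F>"
    by (intro exI[of _ \<F>] conjI)
qed

text \<open>A sequence that leaves the saturations of all \<open>K i\<close> has no limit: the point closures of its tail
  form a closed set, as only finitely many of them meet any given \<open>K i\<close>.\<close>

lemma k_omega_r0_first_countable_imp_locally_compact_space:
  assumes X: "k_omega_space X" and r0: "r0_space X" and fc: "first_countable X"
  shows "locally_compact_space X"
proof -
  obtain K :: "nat \<Rightarrow> 'a set" where K: "\<forall>i. compactin X (K i)" "(\<Union>i. K i) = topspace X"
    and k: "\<forall>U. U \<subseteq> topspace X \<longrightarrow> openin X U \<longleftrightarrow> (\<forall>i. openin (subtopology X (K i)) (U \<inter> K i))"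
    using X unfolding k_omega_space_def by (elim exE conjE)
  define L where "L n = (\<Union>i\<le>n. \<Union>x\<in>K i. X closure_of {x})" for n
  \<comment> \<open>\<open>L n\<close> absorbs relations in both directions: by \<open>R0\<close>, a
    point whose closure meets \<open>K i\<close> lies in the closure of a point of
    \<open>K i\<close>.\<close>
  have sym: "x \<in> L n" if "i \<le> n" "y \<in> K i" "x \<in> topspace X" "y \<in> X closure_of {x}" for i n x y
    using that r0 unfolding L_def r0_space_def by blast
  show ?thesis
  proof (rule first_countable_locally_compactI[OF fc])
    show "compactin X (L n)" for n
      unfolding L_def using compactin_r0_saturation[OF r0] K(1) by (intro compactin_Union) auto
    fix x \<sigma> assume lim: "limitin X \<sigma> x sequentially" and \<sigma>: "\<forall>n. \<sigma> n \<in> topspace X - L n"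
    have "x \<in> topspace X" using lim by (rule limitin_topspace)
    then obtain m where m: "x \<in> K m" using K(2) by blast
    \<comment> \<open>The tail starts at an index \<open>m\<close> with \<open>x \<in> K m\<close>.
      If \<open>x\<close> were in the closure of some \<open>\<sigma> n\<close> with
      \<open>n \<ge> m\<close>, then \<open>\<sigma> n\<close> would lie in \<open>L n\<close>;
      hence \<open>x \<notin> A\<close>.\<close>
    define A where "A = (\<Union>n\<in>{m..}. X closure_of {\<sigma> n})"
    have "openin X (topspace X - A)"
    proof (rule k[rule_format, THEN iffD2, OF Diff_subset], rule allI)
      fix i
      have *: "X closure_of {\<sigma> n} \<inter> K i = {}" if "i \<le> n" for n
        using sym[OF that] \<sigma> by blast
      have "A \<inter> K i \<subseteq> (\<Union>n\<in>{m..<i}. X closure_of {\<sigma> n})"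
      proof
        fix z assume "z \<in> A \<inter> K i"
        then obtain n where "m \<le> n" "z \<in> X closure_of {\<sigma> n}" "z \<in> K i" unfolding A_def by auto
        moreover from this * have "n < i" by (meson disjoint_iff not_less)
        ultimately show "z \<in> (\<Union>n\<in>{m..<i}. X closure_of {\<sigma> n})" by auto
      qed
      then have "(topspace X - A) \<inter> K i = (topspace X - (\<Union>n\<in>{m..<i}. X closure_of {\<sigma> n})) \<inter> K i"
        unfolding A_def by auto
      moreover have "openin X (topspace X - (\<Union>n\<in>{m..<i}. X closure_of {\<sigma> n}))"
        by (intro openin_diff openin_topspace closedin_Union) auto
      ultimately show "openin (subtopology X (K i)) ((topspace X - A) \<inter> K i)"
        unfolding openin_subtopology by blast
    qed
    moreover have "x \<notin> A"
      unfolding A_def using sym[OF _ m] \<sigma> by (meson DiffE UN_E atLeast_iff)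
    ultimately have "\<forall>\<^sub>F n in sequentially. \<sigma> n \<in> topspace X - A"
      using \<open>x \<in> topspace X\<close> lim unfolding limitin_def by blast
    then have "\<exists>n\<ge>m. \<sigma> n \<notin> A"
      using eventually_happens eventually_conj eventually_ge_at_top
      by (metis (mono_tags, lifting) DiffD2 eventually_at_top_linorder linear)
    then obtain n where "n \<ge> m" "\<sigma> n \<notin> A" by blast
    moreover have "\<sigma> n \<in> X closure_of {\<sigma> n}" using \<sigma> by (simp add: in_closure_of)
    ultimately show False unfolding A_def by blast
  qed
qed

text \<open>The interiors of compact sets cover the space, and the Lindelof property leaves
  countably many; finite unions of the compact sets make the sequence increasing.\<close>

lemma locally_compact_second_countable_exhaustion:
  assumes lc: "locally_compact_space X" and sc: "second_countable X"
  obtains K :: "nat \<Rightarrow> 'a set" where "\<And>n. compactin X (K n)" "incseq K"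
    "(\<Union>n. X interior_of K n) = topspace X"
proof -
  let ?\<U> = "{X interior_of K | K. compactin X K}"
  have cover: "topspace X \<subseteq> \<Union>?\<U>"
  proof
    fix x assume "x \<in> topspace X"
    then obtain U K where UK: "openin X U" "compactin X K" "x \<in> U" "U \<subseteq> K"
      using lc unfolding locally_compact_space_def by blast
    then have "x \<in> X interior_of K" using interior_of_maximal by blast
    with UK(2) show "x \<in> \<Union>?\<U>" by blast
  qed
  have "\<exists>\<V>. countable \<V> \<and> \<V> \<subseteq> ?\<U> \<and> topspace X \<subseteq> \<Union>\<V>"
    by (rule second_countable_imp_Lindelof_space[OF sc, unfolded Lindelof_space_alt, rule_format])
       (intro conjI cover ballI, auto)
  then obtain \<V> where \<V>: "countable \<V>" "\<V> \<subseteq> ?\<U>" "topspace X \<subseteq> \<Union>\<V>" by blast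
  \<comment> \<open>Adding the empty set ensures that \<open>from_nat_into\<close> enumerates a
    nonempty family even when \<open>\<V>\<close> is empty.\<close>
  define \<W> where "\<W> = insert {} \<V>"
  have \<W>: "countable \<W>" "\<W> \<noteq> {}" unfolding \<W>_def using \<V>(1) by auto
  have "\<exists>C. compactin X C \<and> from_nat_into \<W> n \<subseteq> X interior_of C" for n
  proof -
    have "from_nat_into \<W> n \<in> \<W>" using \<W> by (simp add: from_nat_into)
    then show ?thesis unfolding \<W>_def using \<V>(2) compactin_empty by blast
  qed
  then obtain C where C: "\<And>n. compactin X (C n)" "\<And>n. from_nat_into \<W> n \<subseteq> X interior_of (C n)"
    by metis
  define K where "K n = (\<Union>i\<le>n. C i)" for n
  show thesis
  proof
    show "compactin X (K n)" for n unfolding K_def using C(1) by (intro compactin_Union) auto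
    show "incseq K" unfolding K_def incseq_def by fastforce
    show "(\<Union>n. X interior_of K n) = topspace X"
    proof
      show "(\<Union>n. X interior_of K n) \<subseteq> topspace X"
        by (intro UN_least interior_of_subset_topspace)
      show "topspace X \<subseteq> (\<Union>n. X interior_of K n)"
      proof
        fix x assume "x \<in> topspace X"
        then obtain V where V: "V \<in> \<W>" "x \<in> V" using \<V>(3) unfolding \<W>_def by blast
        then obtain n where "from_nat_into \<W> n = V" using from_nat_into_surj[OF \<W>(1)] by blast
        moreover have "X interior_of C n \<subseteq> X interior_of K n"
          unfolding K_def by (intro interior_of_mono) auto
        ultimately show "x \<in> (\<Union>n. X interior_of K n)" using C(2)[of n] V by blast
      qed
    qed
  qed
qed

text \<open>Openness relative to \<open>K i\<close> restricts to genuine openness on the interior of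
  \<open>K i\<close>, and these interiors cover the space.\<close>

lemma locally_compact_second_countable_imp_k_omega_space:
  assumes "locally_compact_space X" "second_countable X"
  shows "k_omega_space X"
proof -
  obtain K :: "nat \<Rightarrow> 'a set" where K: "\<And>n. compactin X (K n)"
    "(\<Union>n. X interior_of K n) = topspace X"
    using locally_compact_second_countable_exhaustion[OF assms] by metis
  show ?thesis unfolding k_omega_space_def
  proof (intro exI[of _ K] conjI allI impI iffI K(1))
    show "(\<Union>n. K n) = topspace X"
    proof
      show "(\<Union>n. K n) \<subseteq> topspace X"
        by (intro UN_least compactin_subset_topspace K(1))
      show "topspace X \<subseteq> (\<Union>n. K n)"
        unfolding K(2)[symmetric] by (intro UN_mono subset_refl interior_of_subset)
    qed
    fix U assume U: "U \<subseteq> topspace X"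
    show "openin (subtopology X (K i)) (U \<inter> K i)" if "openin X U" for i
      using that by (rule openin_subtopology_Int)
    assume *: "\<forall>i. openin (subtopology X (K i)) (U \<inter> K i)"
    have "openin X (U \<inter> X interior_of K i)" for i
    proof -
      obtain T where T: "openin X T" "U \<inter> K i = T \<inter> K i"
        using * unfolding openin_subtopology by blast
      then have "U \<inter> X interior_of K i = T \<inter> X interior_of K i"
        using interior_of_subset[of X "K i"] by blast
      then show ?thesis using T by (simp add: openin_Int)
    qed
    then have "openin X (\<Union>i. U \<inter> X interior_of K i)" by blast
    moreover have "(\<Union>i. U \<inter> X interior_of K i) = U" using U K(2) by blast
    ultimately show "openin X U" by simp
  qed
qed

lemma locally_compact_second_countable_imp_hemicompact_space:
  assumes "locally_compact_space X" "second_countable X"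
  shows "hemicompact_space X"
proof -
  obtain K :: "nat \<Rightarrow> 'a set" where K: "\<And>n. compactin X (K n)" "incseq K"
    "(\<Union>n. X interior_of K n) = topspace X"
    using locally_compact_second_countable_exhaustion[OF assms] by metis
  show ?thesis unfolding hemicompact_space_def
  proof (intro exI[of _ K] conjI allI impI K(1))
    fix C assume C: "compactin X C"
    have "\<exists>\<F>. finite \<F> \<and> \<F> \<subseteq> range (\<lambda>n. X interior_of K n) \<and> C \<subseteq> \<Union>\<F>"
      using compactin_subset_topspace[OF C] K(3) by (intro compactinD[OF C]) auto
    then obtain F where F: "finite F" "C \<subseteq> (\<Union>n\<in>F. X interior_of K n)"
      by (metis finite_subset_image)
    \<comment> \<open>Monotonicity replaces the finite subcover by its largest index. For empty
      \<open>F\<close> the value of \<open>Max F\<close> is immaterial, as \<open>C\<close> is then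
      empty.\<close>
    have "X interior_of K n \<subseteq> K (Max F)" if "n \<in> F" for n
      using interior_of_subset[of X "K n"] incseqD[OF K(2), of n "Max F"] that F(1) by auto
    then show "\<exists>i. C \<subseteq> K i" using F(2) by blast
  qed
qed

subsection \<open>Preordered spaces\<close>

text \<open>Closedness of the two hulls of \<open>x\<close> forces \<open>x \<le> y \<le> x\<close>
  for every \<open>y\<close> in the closure of \<open>x\<close>; a convex set containing one of such
  points contains the other.\<close>

lemma locally_convex_semiclosed_imp_r0_space:
  assumes lc: "locally_convex_preordered_space X r" and sc: "semiclosed_preordered_space X r"
  shows "r0_space X"
  unfolding r0_space_def
proof (intro ballI allI impI)
  fix x y assume x: "x \<in> topspace X" and y: "y \<in> X closure_of {x}"
  have "(x, x) \<in> r"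
    using sc x unfolding semiclosed_preordered_space_def preorder_on_def refl_on_def by blast
  then have "{x} \<subseteq> r `` {x}" "{x} \<subseteq> r\<inverse> `` {x}" by auto
  moreover have "closedin X (r `` {x})" "closedin X (r\<inverse> `` {x})"
    using sc x unfolding semiclosed_preordered_space_def by auto
  ultimately have "X closure_of {x} \<subseteq> r `` {x}" "X closure_of {x} \<subseteq> r\<inverse> `` {x}"
    by (simp_all add: closure_of_minimal)
  then have xy: "(x, y) \<in> r" "(y, x) \<in> r" using y by auto
  show "x \<in> X closure_of {y}"
    unfolding in_closure_of_singleton
  proof (intro conjI x allI impI, elim conjE)
    fix W assume "openin X W" "x \<in> W"
    then obtain V where V: "order_convex r V" "x \<in> V" "V \<subseteq> W"
      using lc unfolding locally_convex_preordered_space_def neighbourhood_base_of by blast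
    then show "y \<in> W"
      using xy unfolding order_convex_def increasing_set_def decreasing_set_def by blast
  qed
qed

lemma closed_imp_semiclosed_preordered_space:
  assumes "closed_preordered_space X r"
  shows "semiclosed_preordered_space X r"
  unfolding semiclosed_preordered_space_def
proof (intro conjI ballI)
  show "preorder_on (topspace X) r" using assms unfolding closed_preordered_space_def by blast
  then have rX: "r \<subseteq> topspace X \<times> topspace X" unfolding preorder_on_def refl_on_def by blast
  fix x assume x: "x \<in> topspace X"
  have r: "closedin (prod_topology X X) r" using assms unfolding closed_preordered_space_def by blast
  have "closedin X {y \<in> topspace X. (x, y) \<in> r}"
    using x by (intro closedin_continuous_map_preimage[OF _ r] continuous_map_pairedI) auto
  moreover have "r `` {x} = {y \<in> topspace X. (x, y) \<in> r}" using rX by blast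
  ultimately show "closedin X (r `` {x})" by simp
  have "closedin X {y \<in> topspace X. (y, x) \<in> r}"
    using x by (intro closedin_continuous_map_preimage[OF _ r] continuous_map_pairedI) auto
  moreover have "r\<inverse> `` {x} = {y \<in> topspace X. (y, x) \<in> r}" using rX by blast
  ultimately show "closedin X (r\<inverse> `` {x})" by simp
qed

text \<open>An open rectangle \<open>U \<times> V\<close> about \<open>(x, y)\<close> avoids the
  graph. A common point \<open>z\<close> of \<open>U\<close> and \<open>V\<close> would give
  \<open>(z, z) \<notin> r\<close>, against reflexivity.\<close>

lemma closed_preordered_space_separation:
  assumes "closed_preordered_space X r" "x \<in> topspace X" "y \<in> topspace X" "(x, y) \<notin> r"
  obtains U V where "openin X U" "openin X V" "x \<in> U" "y \<in> V" "disjnt U V"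
proof -
  have r: "closedin (prod_topology X X) r" and refl: "\<And>z. z \<in> topspace X \<Longrightarrow> (z, z) \<in> r"
    using assms(1) unfolding closed_preordered_space_def preorder_on_def refl_on_def by auto
  then have "openin (prod_topology X X) (topspace X \<times> topspace X - r)"
    using openin_diff[OF openin_topspace r] by simp
  then obtain U V where UV: "openin X U" "openin X V" "x \<in> U" "y \<in> V"
      "U \<times> V \<subseteq> topspace X \<times> topspace X - r"
    using assms(2-4) unfolding openin_prod_topology_alt by (metis DiffI SigmaI)
  then have "disjnt U V" unfolding disjnt_def using refl by blast
  with UV show thesis using that by blast
qed

text \<open>If both \<open>x \<le> y\<close> and \<open>y \<le> x\<close> held, convex
  neighbourhoods of \<open>y\<close> would all contain \<open>x\<close>. So one of the two pairs
  lies off the closed graph and can be separated.\<close>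

lemma locally_convex_closed_imp_r1_space:
  assumes lc: "locally_convex_preordered_space X r" and cl: "closed_preordered_space X r"
  shows "r1_space X"
  unfolding r1_space_def
proof (intro ballI impI)
  fix x y assume x: "x \<in> topspace X" and y: "y \<in> topspace X" and n: "y \<notin> X closure_of {x}"
  have "\<not> ((x, y) \<in> r \<and> (y, x) \<in> r)"
  proof
    assume xy: "(x, y) \<in> r \<and> (y, x) \<in> r"
    obtain W where W: "openin X W" "y \<in> W" "x \<notin> W"
      using n y unfolding in_closure_of_singleton by blast
    then obtain V where V: "order_convex r V" "y \<in> V" "V \<subseteq> W"
      using lc unfolding locally_convex_preordered_space_def neighbourhood_base_of by blast
    then have "x \<in> V"
      using xy unfolding order_convex_def increasing_set_def decreasing_set_def by blast
    with W V show False by blast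
  qed
  then consider "(x, y) \<notin> r" | "(y, x) \<notin> r" by blast
  then show "\<exists>U V. openin X U \<and> openin X V \<and> x \<in> U \<and> y \<in> V \<and> disjnt U V"
  proof cases
    case 1
    then show ?thesis using closed_preordered_space_separation[OF cl x y] by blast
  next
    case 2
    then obtain U V where "openin X U" "openin X V" "y \<in> U" "x \<in> V" "disjnt U V"
      by (rule closed_preordered_space_separation[OF cl y x])
    then show ?thesis using disjnt_sym[of U V] by blast
  qed
qed

section \<open>The discrete order and the axioms \<open>T1\<close> and \<open>T2\<close>\<close>

lemma preorder_on_Id_on: "preorder_on S (Id_on S)"
  unfolding preorder_on_def by (auto simp: refl_on_def trans_def)

lemma locally_convex_Id_on: "locally_convex_preordered_space X (Id_on (topspace X))"
proof -
  have "order_convex (Id_on (topspace X)) U" if "openin X U" for U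
    using openin_subset[OF that]
    unfolding order_convex_def increasing_set_def decreasing_set_def
    by (intro exI[of _ U]) auto
  then show ?thesis
    unfolding locally_convex_preordered_space_def neighbourhood_base_of
    using preorder_on_Id_on by blast
qed

lemma semiclosed_Id_on_iff_t1_space:
  "semiclosed_preordered_space X (Id_on (topspace X)) \<longleftrightarrow> t1_space X"
proof -
  have "Id_on (topspace X) `` {x} = {x}" "(Id_on (topspace X))\<inverse> `` {x} = {x}"
    if "x \<in> topspace X" for x using that by auto
  then show ?thesis
    unfolding semiclosed_preordered_space_def t1_space_closedin_singleton
    by (simp add: preorder_on_Id_on)
qed

lemma closed_Id_on_iff_Hausdorff_space:
  "closed_preordered_space X (Id_on (topspace X)) \<longleftrightarrow> Hausdorff_space X"
proof -
  have eq: "(\<lambda>x. (x, x)) ` topspace X = Id_on (topspace X)" by auto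
  show ?thesis
    unfolding closed_preordered_space_def Hausdorff_space_closedin_diagonal eq
    by (simp only: preorder_on_Id_on simp_thms)
qed

subsection \<open>Pseudo-metrizable and pseudo-Polish spaces\<close>

text \<open>Urysohn's metrization argument without point separation: countably many functions form a
  map \<open>F\<close> into real sequences whose pullback topology is that of \<open>X\<close>. As
  \<open>F\<close> may identify points, the pulled-back metric is only a pseudo-metric.\<close>

lemma regular_second_countable_imp_pseudo_metrizable_space:
  fixes X :: "'a topology"
  assumes reg: "regular_space X" and sc: "second_countable X"
  shows "pseudo_metrizable_space X"
proof -
  have normal: "normal_space X"
    by (intro regular_Lindelof_imp_normal_space reg second_countable_imp_Lindelof_space sc)
  obtain \<B> where \<B>: "countable \<B>" "\<And>V. V \<in> \<B> \<Longrightarrow> openin X V"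
    "\<And>U x. openin X U \<Longrightarrow> x \<in> U \<Longrightarrow> \<exists>V\<in>\<B>. x \<in> V \<and> V \<subseteq> U"
    using sc unfolding second_countable_def by metis
  define P where "P = {(U, V). U \<in> \<B> \<and> V \<in> \<B> \<and> X closure_of U \<subseteq> V}"
  have P: "countable P"
    by (rule countable_subset[of _ "\<B> \<times> \<B>"]) (use \<B>(1) in \<open>auto simp: P_def\<close>)
  have "\<exists>f :: 'a \<Rightarrow> real. continuous_map X euclideanreal f \<and>
      (p \<in> P \<longrightarrow> f ` fst p \<subseteq> {0} \<and> f ` (topspace X - snd p) \<subseteq> {1})" for p
  proof (cases "p \<in> P")
    case True
    then obtain U V where p: "p = (U, V)" "U \<in> \<B>" "V \<in> \<B>" "X closure_of U \<subseteq> V"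
      unfolding P_def by blast
    have "closedin X (topspace X - V)" using \<B>(2) p by blast
    moreover have "disjnt (X closure_of U) (topspace X - V)"
      using p(4) by (auto simp: disjnt_def)
    ultimately obtain f :: "'a \<Rightarrow> real" where "continuous_map X euclideanreal f"
      "f ` (X closure_of U) \<subseteq> {0}" "f ` (topspace X - V) \<subseteq> {1}"
      using Urysohn_lemma_alt[OF normal closedin_closure_of] by metis
    moreover have "U \<subseteq> X closure_of U"
      using \<B>(2) p(2) openin_subset by (intro closure_of_subset) blast
    ultimately have "continuous_map X euclideanreal f \<and> f ` U \<subseteq> {0} \<and> f ` (topspace X - V) \<subseteq> {1}"
      by blast
    then show ?thesis using p(1) by auto
  next
    case False
    \<comment> \<open>Off \<open>P\<close> the zero function serves as a default, so
      \<open>f p\<close> is continuous for every \<open>p\<close>. This keeps \<open>F\<close>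
      continuous even if \<open>P\<close> is empty and \<open>from_nat_into\<close> returns an
      arbitrary value.\<close>
    then show ?thesis by (intro exI[of _ "\<lambda>_. 0"]) simp
  qed
  then obtain f :: "_ \<Rightarrow> 'a \<Rightarrow> real" where f: "\<And>p. continuous_map X euclideanreal (f p)"
    "\<And>p. p \<in> P \<Longrightarrow> f p ` fst p \<subseteq> {0}" "\<And>p. p \<in> P \<Longrightarrow> f p ` (topspace X - snd p) \<subseteq> {1}"
    by metis
  define F where "F x n = f (from_nat_into P n) x" for x and n :: nat
  have F: "continuous_map X euclidean F"
    unfolding euclidean_product_topology[symmetric] continuous_map_componentwise_UNIV F_def
    using f(1) by simp
  have "openin X U \<longleftrightarrow> openin (pullback_topology (topspace X) F euclidean) U" for U
  proof
    assume U: "openin X U"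
    have "\<forall>x\<in>U. \<exists>W. open W \<and> F x \<in> W \<and> F -` W \<inter> topspace X \<subseteq> U"
    proof
      fix x assume x: "x \<in> U"
      obtain V where V: "V \<in> \<B>" "x \<in> V" "V \<subseteq> U" using \<B>(3)[OF U x] by blast
      \<comment> \<open>Regularity supplies a closed set between \<open>x\<close> and
        \<open>V\<close>, hence a basic \<open>S'\<close> with \<open>(S', V) \<in> P\<close>. Its
        Urysohn function vanishes at \<open>x\<close> and equals \<open>1\<close> off
        \<open>V\<close>, so the set where this coordinate is below \<open>1\<close> is the required
        \<open>W\<close>.\<close>
      obtain S T where ST: "openin X S" "closedin X T" "x \<in> S" "S \<subseteq> T" "T \<subseteq> V"
        using reg \<B>(2) V unfolding neighbourhood_base_of_closedin[symmetric] neighbourhood_base_of by meson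
      obtain S' where S': "S' \<in> \<B>" "x \<in> S'" "S' \<subseteq> S" using \<B>(3)[OF ST(1,3)] by blast
      have "X closure_of S' \<subseteq> V" using S' ST closure_of_minimal[of S' T X] by blast
      then have p: "(S', V) \<in> P" using S' V unfolding P_def by blast
      then obtain n where n: "from_nat_into P n = (S', V)" using from_nat_into_surj[OF P] by blast
      have "open {g :: nat \<Rightarrow> real. g n < 1}"
        using open_vimage[OF open_lessThan continuous_on_product_coordinates, of n "1::real"]
        by (simp add: vimage_def)
      moreover have "F x n = 0" using f(2)[OF p] S'(2) unfolding F_def n by auto
      moreover have "y \<in> V" if "y \<in> topspace X" "F y n < 1" for y
        using f(3)[OF p] that unfolding F_def n by fastforce
      ultimately show "\<exists>W. open W \<and> F x \<in> W \<and> F -` W \<inter> topspace X \<subseteq> U"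
        using V(3) by (intro exI[of _ "{g. g n < 1}"]) auto
    qed
    then obtain W where W: "\<forall>x\<in>U. open (W x) \<and> F x \<in> W x \<and> F -` W x \<inter> topspace X \<subseteq> U"
      by (rule bchoice[THEN exE])
    have "U = F -` (\<Union>x\<in>U. W x) \<inter> topspace X"
    proof
      show "U \<subseteq> F -` (\<Union>x\<in>U. W x) \<inter> topspace X"
        using W openin_subset[OF U] by auto
      show "F -` (\<Union>x\<in>U. W x) \<inter> topspace X \<subseteq> U"
        using W by auto
    qed
    moreover have "open (\<Union>x\<in>U. W x)" using W by (intro open_UN) simp
    then have "openin euclidean (\<Union>x\<in>U. W x)" by (rule open_openin[THEN iffD1])
    ultimately show "openin (pullback_topology (topspace X) F euclidean) U"
      unfolding openin_pullback_topology by blast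
  next
    assume "openin (pullback_topology (topspace X) F euclidean) U"
    then obtain V where V: "openin euclidean V" "U = {x \<in> topspace X. F x \<in> V}"
      unfolding openin_pullback_topology by blast
    show "openin X U" unfolding V(2) by (rule openin_continuous_map_preimage[OF F V(1)])
  qed
  then have "X = pullback_topology (topspace X) F (euclidean :: (nat \<Rightarrow> real) topology)"
    by (simp add: topology_eq)
  moreover have "euclidean = pseudometric_topology (UNIV :: (nat \<Rightarrow> real) set) dist"
    unfolding Met_TC.pseudometric_topology_eq_mtopology
    by (simp add: topology_eq open_openin[symmetric])
  ultimately show ?thesis
    using pseudo_metrizable_space_pullback[OF Met_TC.pseudometric_on, of F "topspace X"] by simp
qed

text \<open>Singletons are compact, so the hemicompact sequence covers the space and total
  boundedness of its members applies.\<close>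

lemma pseudo_metrizable_hemicompact_imp_second_countable:
  assumes "pseudo_metrizable_space X" "hemicompact_space X"
  shows "second_countable X"
proof -
  obtain M d where Md: "pseudometric_on M d" "X = pseudometric_topology M d"
    using assms(1) unfolding pseudo_metrizable_space_def by blast
  obtain K :: "nat \<Rightarrow> 'a set" where K: "\<forall>i. compactin X (K i)" "\<forall>C. compactin X C \<longrightarrow> (\<exists>i. C \<subseteq> K i)"
    using assms(2) unfolding hemicompact_space_def by (elim exE conjE)
  have "x \<in> (\<Union>i. K i)" if "x \<in> M" for x
  proof -
    have "compactin X {x}" using that Md(2) by simp
    then show ?thesis using K(2) by blast
  qed
  then show ?thesis
    using second_countable_pseudometric_sigma_compact[OF Md(1), of K] K(1) Md(2) by blast
qed

lemma pseudo_metrizable_hemicompact_imp_locally_compact: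
  assumes "pseudo_metrizable_space X" "hemicompact_space X"
  shows "locally_compact_space X"
  using assms by (intro hemicompact_first_countable_imp_locally_compact_space
      second_countable_imp_first_countable pseudo_metrizable_hemicompact_imp_second_countable)

section \<open>Polish and pseudo-Polish spaces\<close>

lemma completely_metrizable_second_countable_imp_Polish_space:
  assumes "completely_metrizable_space X" "second_countable X"
  shows "Polish_space X"
proof -
  obtain M d where Md: "Metric_space M d" "Metric_space.mcomplete M d" "X = Metric_space.mtopology M d"
    using assms(1) unfolding completely_metrizable_space_def by blast
  then show ?thesis
    unfolding Polish_space_def
    using second_countable_imp_separable_space[OF assms(2)] homeomorphic_space_refl by metis
qed

lemma Polish_space_imp_second_countable:
  assumes "Polish_space X"
  shows "second_countable X"
proof -
  obtain M :: "'a set" and d where Md: "Metric_space M d" "separable_space (Metric_space.mtopology M d)"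
      "X homeomorphic_space Metric_space.mtopology M d"
    using assms unfolding Polish_space_def by blast
  then show ?thesis
    using second_countable_separable_mtopology homeomorphic_space_second_countability by blast
qed

text \<open>Two pullbacks are at work: along the homeomorphism for the pseudo-metric, and along the
  class map for the countable base of the Polish quotient.\<close>

lemma pseudo_Polish_space_imp_pseudo_metrizable_second_countable:
  assumes "pseudo_Polish_space X"
  shows "pseudo_metrizable_space X" "second_countable X"
proof -
  obtain M :: "'a set" and d where Md: "pseudometric_on M d"
      "X homeomorphic_space pseudometric_topology M d"
      "Polish_space (Metric_space.mtopology (M // pseudometric_rel M d) (quotient_dist M d))"
    using assms unfolding pseudo_Polish_space_def by blast
  obtain f where f: "homeomorphic_map X (pseudometric_topology M d) f"
    using Md(2) unfolding homeomorphic_space by blast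
  then have "f ` topspace X \<subseteq> M" using homeomorphic_imp_surjective_map by fastforce
  then have "pseudo_metrizable_space (pullback_topology (topspace X) f (pseudometric_topology M d))"
    by (rule pseudo_metrizable_space_pullback[OF Md(1)])
  then show "pseudo_metrizable_space X"
    using homeomorphic_map_imp_pullback_topology[OF f] by simp
  have "second_countable (pseudometric_topology M d)"
    unfolding pseudometric_topology_eq_pullback_quotient[OF Md(1)]
    by (intro second_countable_pullback_topology Polish_space_imp_second_countable Md(3))
  then show "second_countable X"
    using homeomorphic_space_second_countability[OF Md(2)] by simp
qed

lemma locally_compact_pseudo_metrizable_imp_pseudo_Polish_space:
  assumes "pseudo_metrizable_space X" "locally_compact_space X" "second_countable X"
  shows "pseudo_Polish_space X"
proof -
  obtain M d where Md: "pseudometric_on M d" "X = pseudometric_topology M d"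
    using assms(1) unfolding pseudo_metrizable_space_def by blast
  let ?Q = "M // pseudometric_rel M d"
  let ?c = "\<lambda>x. pseudometric_rel M d `` {x}"
  interpret Q: Metric_space ?Q "quotient_dist M d"
    by (rule Metric_space_quotient_dist[OF Md(1)])
  have X: "X = pullback_topology M ?c Q.mtopology"
    using pseudometric_topology_eq_pullback_quotient[OF Md(1)] Md(2) by simp
  have im: "?c ` M = topspace Q.mtopology"
    unfolding Q.topspace_mtopology by (auto simp: quotient_def)
  \<comment> \<open>The class map is a continuous open surjection onto the quotient. It transfers
    local compactness, which makes a metric space completely metrizable, as well as second
    countability.\<close>
  note c = continuous_open_map_pullback_topology[OF im, folded X]
  have im': "?c ` topspace X = topspace Q.mtopology" using im Md(2) by simp
  have "locally_compact_space Q.mtopology"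
    by (rule locally_compact_space_continuous_open_map_image[OF c im' assms(2)])
  then have "completely_metrizable_space Q.mtopology"
    by (rule Q.locally_compact_imp_completely_metrizable_space)
  moreover have "second_countable Q.mtopology"
    by (rule second_countable_open_map_image[OF c im' assms(3)])
  ultimately have "Polish_space Q.mtopology"
    by (rule completely_metrizable_second_countable_imp_Polish_space)
  then show ?thesis
    unfolding pseudo_Polish_space_def using Md homeomorphic_space_refl by blast
qed

theorem proposition3p1:
  fixes X :: "'a topology" and r :: "'a rel"
  assumes "preorder_on (topspace X) r"
  shows "let P1 = (second_countable X \<and> k_omega_space X);
             P2 = (second_countable X \<and> locally_compact_space X);
             P3 = (pseudo_metrizable_space X \<and> hemicompact_space X \<and> k_space X);
             P4 = (locally_compact_space X \<and> pseudo_Polish_space X)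
         in (P4 \<longleftrightarrow> P3) \<and> (P3 \<longrightarrow> P2) \<and> (P2 \<longrightarrow> P1) \<and>
            (locally_convex_preordered_space X r \<and> semiclosed_preordered_space X r
               \<longrightarrow> (P1 \<longrightarrow> P2)) \<and>
            (locally_convex_preordered_space X r \<and> closed_preordered_space X r
               \<longrightarrow> (P2 \<longrightarrow> P3)) \<and>
            locally_convex_preordered_space X (Id_on (topspace X)) \<and>
            (t1_space X \<longrightarrow> (P1 \<longrightarrow> P2)) \<and>
            (Hausdorff_space X \<longrightarrow> (P2 \<longrightarrow> P3)) \<and>
            (locally_convex_preordered_space X r \<and> closed_preordered_space X r
               \<longrightarrow> (P1 \<longleftrightarrow> P2) \<and> (P2 \<longleftrightarrow> P3) \<and> (P3 \<longleftrightarrow> P4)) \<and>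
            (Hausdorff_space X
               \<longrightarrow> (P1 \<longleftrightarrow> P2) \<and> (P2 \<longleftrightarrow> P3) \<and> (P3 \<longleftrightarrow> P4))"
proof -
  define P1 where "P1 \<longleftrightarrow> second_countable X \<and> k_omega_space X"
  define P2 where "P2 \<longleftrightarrow> second_countable X \<and> locally_compact_space X"
  define P3 where "P3 \<longleftrightarrow> pseudo_metrizable_space X \<and> hemicompact_space X \<and> k_space X"
  define P4 where "P4 \<longleftrightarrow> locally_compact_space X \<and> pseudo_Polish_space X"
  have P32: "P3 \<longrightarrow> P2"
    unfolding P2_def P3_def
    using pseudo_metrizable_hemicompact_imp_second_countable
      pseudo_metrizable_hemicompact_imp_locally_compact by blast
  \<comment> \<open>Hemicompactness and the \<open>k\<close>-space property follow from
    \<open>P2\<close> alone, so pseudo-metrizability is all that separates \<open>P2\<close> from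
    \<open>P3\<close>.\<close>
  have P23: "P3" if "P2" "pseudo_metrizable_space X"
    using that locally_compact_second_countable_imp_hemicompact_space locally_compact_imp_k_space
    unfolding P2_def P3_def by blast
  have P43: "P4 \<longleftrightarrow> P3"
  proof
    assume P4
    then show P3
      using P23 pseudo_Polish_space_imp_pseudo_metrizable_second_countable
      unfolding P4_def P2_def by blast
  next
    assume P3
    then show P4
      using P32 locally_compact_pseudo_metrizable_imp_pseudo_Polish_space
      unfolding P4_def P2_def P3_def by blast
  qed
  have P21: "P2 \<longrightarrow> P1"
    unfolding P1_def P2_def using locally_compact_second_countable_imp_k_omega_space by blast
  \<comment> \<open>The preorder \<open>s\<close> is left arbitrary so that both \<open>r\<close>
    and the discrete order can be inserted; the latter yields the \<open>T1\<close> case, and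
    likewise the Hausdorff case of \<open>P23c\<close>.\<close>
  have P12: "P1 \<longrightarrow> P2"
    if "locally_convex_preordered_space X s" "semiclosed_preordered_space X s" for s
    using k_omega_r0_first_countable_imp_locally_compact_space
      locally_convex_semiclosed_imp_r0_space[OF that] second_countable_imp_first_countable
    unfolding P1_def P2_def by blast
  have P23c: "P2 \<longrightarrow> P3"
    if "locally_convex_preordered_space X s" "closed_preordered_space X s" for s
    using P23 regular_second_countable_imp_pseudo_metrizable_space
      locally_compact_r1_imp_regular_space[OF _ locally_convex_closed_imp_r1_space[OF that]]
    unfolding P2_def by blast
  have t1: "P1 \<longrightarrow> P2" if "t1_space X"
    using P12[OF locally_convex_Id_on] that semiclosed_Id_on_iff_t1_space by blast
  have t2: "P2 \<longrightarrow> P3" if "Hausdorff_space X"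
    using P23c[OF locally_convex_Id_on] that closed_Id_on_iff_Hausdorff_space by blast
  show ?thesis
    unfolding Let_def P1_def[symmetric] P2_def[symmetric] P3_def[symmetric] P4_def[symmetric]
    using P43 P32 P21 P12[of r] P23c[of r] locally_convex_Id_on t1 t2
      closed_imp_semiclosed_preordered_space[of X r] Hausdorff_imp_t1_space[of X]
    by blast
qed

end
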